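(* Let $T\subset\mathbb{R}^n$ be a compact set with $T=\overline{T^\circ}$ and $\mathcal{J}\subset\mathbb{R}^n$ a discrete set, normalized so that $\mathbf{0}\in T$, $\mathbf{0}\in\mathcal{J}$, $T\subset(\mathbb{R}^+)^n$ and $\mathcal{J}\subset(\mathbb{R}^+)^n$. If $(T,\mathcal{J})$ is a translation tiling of $(\mathbb{R}^+)^n$, then there exist sets $E,\mathcal{J}'\subset(\mathbb{Z}^+)^n$ and a diagonal matrix $U=\operatorname{diag}(u_1,\dots,u_n)$ with positive diagonal entries such that $$UT=E+[0,1]^n,\qquad U\mathcal{J}=\mathcal{J}',$$ and $(E,\mathcal{J}')$ is a translation tiling of $(\mathbb{Z}^+)^n$.
   Context: $\mathbb{R}^+=\{x\in\mathbb{R}:x\ge0\}$, $\mathbb{Z}^+=\{x\in\mathbb{Z}:x\ge 0\}$. $T^\circ$ is the interior of $T$ and $\overline{T^\circ}$ its closure. $(T,\mathcal{J})$ is a translation tiling of $(\mathbb{R}^+)^n$ if $T+\mathcal{J}=(\mathbb{R}^+)^n$ and $(T+t_1)\cap(T+t_2)$ has Lebesgue measure zero for all $t_1\ne t_2$ in $\mathcal{J}$. For $A,B\subset(\mathbb{Z}^+)^n$, $(A,B)$ is a (translation) tiling of $(\mathbb{Z}^+)^n$ if $A$ is finite and every element of $(\mathbb{Z}^+)^n$ can be written in exactly one way as $a+b$ with $a\in A$, $b\in B$ (i.e. $A\oplus B=(\mathbb{Z}^+)^n$). *)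

theory Defs
  imports "HOL-Analysis.Analysis"
begin

definition nonneg_orthant :: "(real ^ 'n) set" where
  "nonneg_orthant = {x. \<forall>i. 0 \<le> x $ i}"

text \<open>The lattice points of the orthant are kept as real vectors, so that they can be compared
  directly with linear images of subsets of \<open>real ^ 'n\<close>.\<close>

definition nonneg_int_orthant :: "(real ^ 'n) set" where
  "nonneg_int_orthant = {x. \<forall>i. x $ i \<in> \<int> \<and> 0 \<le> x $ i}"

text \<open>Here \<open>T + J\<close> is the Minkowski sum from \<open>HOL-Library.Set_Algebras\<close>.\<close>

definition orthant_tiling :: "(real ^ 'n) set \<Rightarrow> (real ^ 'n) set \<Rightarrow> bool" where
  "orthant_tiling T J \<longleftrightarrow>
     T + J = nonneg_orthant \<and>
     (\<forall>t1\<in>J. \<forall>t2\<in>J. t1 \<noteq> t2 \<longrightarrow>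
        ((\<lambda>x. x + t1) ` T) \<inter> ((\<lambda>x. x + t2) ` T) \<in> null_sets lebesgue)"

definition int_orthant_tiling :: "(real ^ 'n) set \<Rightarrow> (real ^ 'n) set \<Rightarrow> bool" where
  "int_orthant_tiling A B \<longleftrightarrow>
     A \<subseteq> nonneg_int_orthant \<and> B \<subseteq> nonneg_int_orthant \<and> finite A \<and>
     (\<forall>x\<in>nonneg_int_orthant. \<exists>!(a, b). a \<in> A \<and> b \<in> B \<and> x = a + b)"

definition diag_matrix :: "real ^ 'n \<Rightarrow> real ^ 'n ^ 'n" where
  "diag_matrix u = (\<chi> i j. if i = j then u $ i else 0)"

end

theory Submission
  imports Defs
begin

text \<open>
  Since \<open>T\<close> is the closure of its interior, measure-disjointness of the translates amounts to a purely
  topological fact: for distinct \<open>j, j' \<in> J\<close> the open set \<open>interior T + j\<close> misses \<open>T + j'\<close>. As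
  \<open>interior T\<close> contains a ball, the points of \<open>J\<close> are uniformly separated, so only finitely many of
  them lie below a given point of the orthant, and only these matter near that point: a translate
  \<open>T + j\<close> consists of points above \<open>j\<close>.

  The unit of length on each axis is forced. Along the \<open>i\<close>-th axis only translates with \<open>j\<close> on that axis
  can occur, so \<open>J\<close> has a least positive point \<open>a\<^sub>i e\<^sub>i\<close> there; after rescaling by \<open>u\<^sub>i = 1 / a\<^sub>i\<close> this
  point is \<open>e\<^sub>i\<close>, and \<open>T\<close> alone covers the orthant just above each point of the half-open segments
  \<open>[0, 1) e\<^sub>i\<close>.

  The heart is a well-founded induction over the lattice points \<open>z\<close> of the orthant, ordered
  componentwise, for the claim \<open>cell_fits z\<close>: no point of \<open>J\<close> rounds down to \<open>z\<close> except possibly \<open>z\<close>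
  itself, and the open unit cell \<open>z + (0, 1)\<^sup>n\<close> lies inside \<open>T\<close> or outside \<open>T\<close>. Lattice points
  \<open>j \<noteq> 0\<close> of \<open>J\<close> cover all or nothing of the cell, by the induction hypothesis for \<open>z - j\<close>. If one of them
  covers all, nothing else meets the cell. If none of them meets it, suppose that some fractional
  \<open>m \<in> J\<close> rounds down to \<open>z\<close>, and choose \<open>m\<close> minimal. Let \<open>f > 0\<close> be the fractional part of one of its
  coordinates, say the \<open>i\<close>-th. By minimality only \<open>T\<close> itself can cover the orthant just above
  \<open>x = m - f e\<^sub>i\<close>; so \<open>T + e\<^sub>i\<close> covers it just above \<open>x + e\<^sub>i = m + (1 - f) e\<^sub>i\<close>. But \<open>T + m\<close> covers it there
  too, because \<open>(1 - f) e\<^sub>i\<close> is in the half-open unit segment; this is a forbidden overlap. Hence no such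
  \<open>m\<close> exists, and \<open>T\<close> fills the cell (\<open>cell_fits_step\<close>).

  It follows that \<open>J\<close> is integral, that \<open>T\<close> is the union of the closed unit cells whose interiors it
  contains, and that evaluating the tiling at the centres of the cells gives the tiling of the lattice.
\<close>

section \<open>Topological form of the tiling condition\<close>

lemma mem_nonneg_orthant: "x \<in> nonneg_orthant \<longleftrightarrow> 0 \<le> x"
  by (simp add: nonneg_orthant_def less_eq_vec_def)

lemma diag_matrix_mult_nth: "(diag_matrix u *v x) $ i = u $ i * x $ i"
  by (simp add: diag_matrix_def matrix_vector_mult_def if_distrib[of "\<lambda>c. c * _"] cong: if_cong)

lemma box_imp_le:
  fixes a b y :: "real ^ 'n"
  assumes "y \<in> box a b"
  shows "a \<le> y" "y \<le> b"
  using assms by (auto simp: mem_box_cart less_eq_vec_def less_imp_le)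

text \<open>The assumption \<open>separated\<close> replaces measure-disjointness. It is asymmetric, with an interior point on
  one side only, so that it excludes overlaps of an open piece of one translate with any point,
  possibly a boundary point, of another.\<close>

locale orthant_tile =
  fixes T J :: "(real ^ 'n) set"
  assumes compact_T: "compact T"
    and regular_T: "T = closure (interior T)"
    and zero_J: "0 \<in> J"
    and nonneg_T: "\<And>t. t \<in> T \<Longrightarrow> 0 \<le> t"
    and nonneg_J: "\<And>j. j \<in> J \<Longrightarrow> 0 \<le> j"
    and cover: "\<And>x. 0 \<le> x \<Longrightarrow> \<exists>t\<in>T. \<exists>j\<in>J. x = t + j"
    and separated: "\<And>s t j j'. \<lbrakk>s \<in> interior T; t \<in> T; j \<in> J; j' \<in> J; s + j = t + j'\<rbrakk> \<Longrightarrow> j = j'"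

text \<open>Two translated interiors meet in an open null set, which is empty; and an open set that misses
  \<open>interior T + j'\<close> misses its closure \<open>T + j'\<close>.\<close>

lemma orthant_tile_of_orthant_tiling:
  fixes T J :: "(real ^ 'n) set"
  assumes "compact T" and reg: "T = closure (interior T)"
    and "0 \<in> J" and "T \<subseteq> nonneg_orthant" and "J \<subseteq> nonneg_orthant"
    and til: "orthant_tiling T J"
  shows "orthant_tile T J"
proof
  show "\<exists>t\<in>T. \<exists>j\<in>J. x = t + j" if "0 \<le> x" for x
  proof -
    have "x \<in> T + J" using til that by (simp add: orthant_tiling_def mem_nonneg_orthant)
    then show ?thesis by (auto elim!: set_plus_elim)
  qed
  show "j = j'" if s: "s \<in> interior T" and t: "t \<in> T" and J: "j \<in> J" "j' \<in> J" and eq: "s + j = t + j'"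
    for s t j j'
  proof (rule ccontr)
    assume "j \<noteq> j'"
    define V where "V = (\<lambda>x. x + j) ` interior T"
    define W where "W = (\<lambda>x. x + j') ` interior T"
    have "open V" "open W"
      unfolding V_def W_def by (auto intro!: open_translation_subtract[of _ "- j" for j, simplified])
    have "V \<inter> W \<subseteq> ((\<lambda>x. x + j) ` T) \<inter> ((\<lambda>x. x + j') ` T)"
      unfolding V_def W_def using interior_subset[of T] by blast
    moreover have "((\<lambda>x. x + j) ` T) \<inter> ((\<lambda>x. x + j') ` T) \<in> null_sets lebesgue"
      using til J \<open>j \<noteq> j'\<close> by (simp add: orthant_tiling_def)
    ultimately have "negligible (V \<inter> W)"
      using negligible_iff_null_sets negligible_subset by blast
    then have "V \<inter> W = {}"
      using open_not_negligible[of "V \<inter> W"] \<open>open V\<close> \<open>open W\<close> by (meson open_Int)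
    then have "V \<inter> closure W = {}"
      using \<open>open V\<close> by (simp add: open_Int_closure_eq_empty)
    moreover have "closure W = (\<lambda>x. x + j') ` T"
      using closure_translation[of j' "interior T"] reg unfolding W_def by (simp add: add.commute)
    moreover have "s + j \<in> V" using s by (simp add: V_def)
    moreover have "s + j \<in> (\<lambda>x. x + j') ` T" using t eq by auto
    ultimately show False by blast
  qed
qed (use assms in \<open>auto simp flip: mem_nonneg_orthant\<close>)

section \<open>Local structure of the translates\<close>

context orthant_tile
begin

lemma interior_nonempty: "interior T \<noteq> {}"
proof -
  have "T \<noteq> {}" using cover[of 0] by auto
  then show ?thesis using regular_T by auto
qed

text \<open>If \<open>ball c r\<close> lies in the interior, two points of \<open>J\<close> closer than \<open>r\<close> would give overlapping
  translates; so \<open>J\<close> is uniformly discrete.\<close>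

lemma finite_J_bounded: 
  assumes "bounded B"
  shows "finite (J \<inter> B)"
proof -
  obtain c where "c \<in> interior T" using interior_nonempty by auto
  then obtain r where r: "r > 0" "ball c r \<subseteq> interior T"
    using open_contains_ball open_interior by meson
  have "j = j'" if "j \<in> J" "j' \<in> J" "dist j j' < r" for j j'
  proof (rule separated)
    show "c + j' - j \<in> interior T" 
      using r that by (auto simp: dist_norm algebra_simps intro!: subsetD[OF r(2)])
    show "c \<in> T" using r interior_subset[of T] by (auto simp: subset_iff)
  qed (use that in auto)
  then have "uniform_discrete (J \<inter> B)"
    using r(1) by (auto simp: uniform_discrete_def)
  then show ?thesis using assms uniform_discrete_finite_iff bounded_Int by blast
qed

lemma finite_J_below: "finite {j \<in> J. j \<le> x}"
proof -
  have "{j \<in> J. j \<le> x} = J \<inter> {0..x}" using nonneg_J by auto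
  then show ?thesis using finite_J_bounded[of "{0..x}"]
    by (simp add: interval_cbox_cart)
qed

text \<open>\<open>T\<close> covers the orthant locally just above \<open>x\<close>. Following the diagonal direction is enough, since
  membership in the interior already provides an open piece of \<open>T\<close>; and two such conditions combine
  by intersecting filters, without any bookkeeping of radii.\<close>

definition corner :: "real ^ 'n \<Rightarrow> bool"
  where "corner x \<longleftrightarrow> (\<forall>\<^sub>F e in at_right 0. x + e *\<^sub>R 1 \<in> interior T)"

text \<open>The form of overlap that rules out fractional translates in \<open>cell_fits_step\<close>: two tiles that are known
  only locally, at points which need not be interior to either.\<close>

lemma corners_disjoint:
  assumes "corner x" "corner x'" "j \<in> J" "j' \<in> J" "x + j = x' + j'"
  shows "j = j'"
proof -
  have "\<forall>\<^sub>F e in at_right (0::real). x + e *\<^sub>R 1 \<in> interior T \<and> x' + e *\<^sub>R 1 \<in> interior T"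
    using assms by (simp add: corner_def eventually_conj)
  then obtain e :: real where "x + e *\<^sub>R 1 \<in> interior T" "x' + e *\<^sub>R 1 \<in> interior T"
    using eventually_happens' trivial_limit_at_right_real by blast
  then show ?thesis
    using separated[of "x + e *\<^sub>R 1" "x' + e *\<^sub>R 1" j j'] assms interior_subset[of T] by (auto simp: algebra_simps)
qed

text \<open>Locally just above \<open>x\<close>, only translates by points \<open>j \<le> x\<close> are present: there are finitely many
  candidates, and each one with \<open>\<not> j \<le> x\<close> exceeds \<open>x\<close> by a definite amount in some coordinate.\<close>

lemma eventually_J_below:
  "\<forall>\<^sub>F e in at_right (0::real). \<forall>j\<in>J. j \<le> x + e *\<^sub>R 1 \<longrightarrow> j \<le> x"
proof -
  have "\<forall>\<^sub>F e in at_right (0::real). \<not> j \<le> x + e *\<^sub>R 1" if not: "\<not> j \<le> x" for j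
  proof -
    obtain i where "x $ i < j $ i" using not by (auto simp: less_eq_vec_def not_le)
    then have "\<forall>\<^sub>F e in at_right (0::real). e < j $ i - x $ i"
      by (intro order_tendstoD[of _ 0] tendsto_ident_at) auto
    then show ?thesis
      by eventually_elim (auto simp: less_eq_vec_def not_le intro!: exI[of _ i])
  qed
  then have "\<forall>\<^sub>F e in at_right (0::real). j \<le> x + e *\<^sub>R 1 \<longrightarrow> j \<le> x" for j
    by (cases "j \<le> x") (auto elim: eventually_mono)
  then have "\<forall>\<^sub>F e in at_right (0::real). \<forall>j\<in>{j \<in> J. j \<le> x + 1}. j \<le> x + e *\<^sub>R 1 \<longrightarrow> j \<le> x"
    by (intro eventually_ball_finite finite_J_below) blast
  moreover have "\<forall>\<^sub>F e in at_right (0::real). e < 1"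
    by (intro order_tendstoD[of _ 0] tendsto_ident_at) auto
  ultimately show ?thesis
  proof eventually_elim
    case (elim e)
    have "x + e *\<^sub>R 1 \<le> x + 1" using elim(2) by (simp add: less_eq_vec_def)
    then show ?case using elim(1) order_trans[of _ "x + e *\<^sub>R 1" "x + 1"] by blast
  qed
qed

text \<open>If all translates other than \<open>T\<close> itself are excluded near \<open>x\<close>, then \<open>T\<close> must do the covering there.\<close>

lemma cornerI:
  assumes "0 \<le> x" and "d > 0"
    and only: "\<And>j t. \<lbrakk>j \<in> J; t \<in> T; j \<le> x; t + j \<in> box x (x + d *\<^sub>R 1)\<rbrakk> \<Longrightarrow> j = 0"
  shows "corner x"
proof -
  have "\<forall>\<^sub>F e in at_right (0::real). e < d"
    using \<open>d > 0\<close> by (intro order_tendstoD[of _ 0] tendsto_ident_at) auto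
  then have "\<forall>\<^sub>F e in at_right (0::real). e < d \<and> (\<forall>j\<in>J. j \<le> x + e *\<^sub>R 1 \<longrightarrow> j \<le> x) \<and> e > 0"
    using eventually_J_below by (intro eventually_conj eventually_at_right_less)
  then obtain e :: real where e: "0 < e" "e < d" "\<forall>j\<in>J. j \<le> x + e *\<^sub>R 1 \<longrightarrow> j \<le> x"
    using eventually_happens' trivial_limit_at_right_real by blast
  have "box x (x + e *\<^sub>R 1) \<subseteq> T"
  proof
    fix y assume y: "y \<in> box x (x + e *\<^sub>R 1)"
    then have "0 \<le> y" using \<open>0 \<le> x\<close> box_imp_le(1) order_trans by blast
    then obtain t j where tj: "t \<in> T" "j \<in> J" "y = t + j" using cover by blast
    have "j \<le> y" using nonneg_T[OF tj(1)] tj(3) by simp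
    then have "j \<le> x + e *\<^sub>R 1" using box_imp_le(2)[OF y] order_trans by blast
    then have "j \<le> x" using e tj by blast
    moreover have "y \<in> box x (x + d *\<^sub>R 1)" 
      using y e(2) by (auto simp: mem_box_cart) (smt (verit))
    ultimately have "j = 0" using only tj by blast
    then show "y \<in> T" using tj by simp
  qed
  then have sub: "box x (x + e *\<^sub>R 1) \<subseteq> interior T" by (simp add: interior_maximal open_box)
  have "\<forall>\<^sub>F r in at_right (0::real). r < e"
    using e by (intro order_tendstoD[of _ 0] tendsto_ident_at) auto
  moreover have "\<forall>\<^sub>F r in at_right (0::real). 0 < r" by (rule eventually_at_right_less)
  ultimately show ?thesis unfolding corner_def
    by eventually_elim (auto intro!: subsetD[OF sub] simp: mem_box_cart)
qed

text \<open>A point on the axis far beyond \<open>T\<close> is covered by a translate whose \<open>j\<close>, being nonnegative and below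
  that point, lies on the axis and is not \<open>0\<close>. Local finiteness then gives a least one.\<close>

lemma least_on_axis:
  "\<exists>a>0. axis i a \<in> J \<and> (\<forall>s>0. axis i s \<in> J \<longrightarrow> a \<le> s)"
proof -
  obtain M where M: "\<And>t. t \<in> T \<Longrightarrow> norm t \<le> M"
    using compact_imp_bounded[OF compact_T] by (auto simp: bounded_iff)
  define p where "p = (axis i (\<bar>M\<bar> + 1) :: real ^ 'n)"
  have "0 \<le> p" by (simp add: p_def less_eq_vec_def axis_def)
  then obtain t j where tj: "t \<in> T" "j \<in> J" "p = t + j" using cover by blast
  have t0: "0 \<le> t $ k" and j0: "0 \<le> j $ k" for k
    using nonneg_T nonneg_J tj by (auto simp: less_eq_vec_def)
  have "j $ k = 0" if "k \<noteq> i" for k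
    using tj(3) t0[of k] j0[of k] that by (simp add: p_def vec_eq_iff axis_def) (smt (verit))
  then have j: "j = axis i (j $ i)" by (auto simp: vec_eq_iff axis_def)
  have "t $ i \<le> M" using M[OF tj(1)] component_le_norm_cart[of t i] by simp
  moreover have "t $ i + j $ i = \<bar>M\<bar> + 1"
    using tj(3) by (metis axis_nth p_def vector_add_component)
  ultimately have "0 < j $ i" by linarith
  define A where "A = {s. 0 < s \<and> s \<le> j $ i \<and> axis i s \<in> J}"
  have "finite A"
  proof (rule finite_imageD)
    show "finite (axis i ` A)"
      by (rule finite_subset[OF _ finite_J_below[of j]])
         (use j0 in \<open>auto simp: A_def less_eq_vec_def axis_def\<close>)
    show "inj_on (axis i) A" by (auto simp: inj_on_def axis_eq_axis)
  qed
  moreover have "j $ i \<in> A" using \<open>0 < j $ i\<close> j tj by (auto simp: A_def)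
  ultimately have min: "Min A \<in> A" "\<And>s. s \<in> A \<Longrightarrow> Min A \<le> s" by (auto intro: Min_in)
  have "Min A \<le> s" if "0 < s" "axis i s \<in> J" for s
    using min(1) min(2)[of s] that by (cases "s \<le> j $ i") (auto simp: A_def)
  then show ?thesis using min(1) by (auto simp: A_def)
qed

lemma orthant_tile_diag:
  assumes u: "\<And>i. 0 < u $ i"
  shows "orthant_tile ((\<lambda>x. diag_matrix u *v x) ` T) ((\<lambda>x. diag_matrix u *v x) ` J)"
proof -
  let ?D = "\<lambda>x. diag_matrix u *v x"
  have lin: "linear ?D" by simp
  have nz: "u $ i \<noteq> 0" for i using u[of i] by simp
  have inj: "inj ?D" by (auto simp: inj_def vec_eq_iff diag_matrix_mult_nth nz)
  have pos: "0 \<le> ?D x \<longleftrightarrow> 0 \<le> x" for x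
    by (simp add: less_eq_vec_def diag_matrix_mult_nth u
        mult_le_cancel_left_pos[where a = 0, unfolded mult_zero_right])
  have surj: "\<exists>y. x = ?D y" for x
    using linear_injective_imp_surjective[OF lin inj] by (auto simp: surj_def)
  show ?thesis
  proof
    show "compact (?D ` T)" 
      by (intro compact_continuous_image compact_T matrix_vector_mult_linear_continuous_on)
    show "?D ` T = closure (interior (?D ` T))"
      by (simp add: interior_injective_linear_image[OF lin inj]
          closure_injective_linear_image[OF lin inj, symmetric] regular_T[symmetric])
    show "0 \<in> ?D ` J" using zero_J by (auto intro!: image_eqI[of _ _ 0])
    show "0 \<le> t" if "t \<in> ?D ` T" for t using that nonneg_T pos by auto
    show "0 \<le> t" if "t \<in> ?D ` J" for t using that nonneg_J pos by auto
    show "\<exists>t\<in>?D ` T. \<exists>j\<in>?D ` J. x = t + j" if "0 \<le> x" for x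
    proof -
      obtain y where y: "x = ?D y" using surj by blast
      then have "0 \<le> y" using that pos by simp
      then obtain t j where "t \<in> T" "j \<in> J" "y = t + j" using cover by blast
      then show ?thesis using y by (auto simp: matrix_vector_right_distrib)
    qed
    show "j = j'" if s: "s \<in> interior (?D ` T)" and t: "t \<in> ?D ` T" and J: "j \<in> ?D ` J" "j' \<in> ?D ` J"
      and eq: "s + j = t + j'" for s t j j'
    proof -
      obtain s0 t0 where st: "s0 \<in> interior T" "s = ?D s0" "t0 \<in> T" "t = ?D t0"
        using s t by (auto simp: interior_injective_linear_image[OF lin inj])
      obtain j0 j0' where j: "j0 \<in> J" "j = ?D j0" "j0' \<in> J" "j' = ?D j0'" using J by blast
      have "?D (s0 + j0) = ?D (t0 + j0')" using eq st j by (simp add: matrix_vector_right_distrib)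
      then have "s0 + j0 = t0 + j0'" by (rule injD[OF inj])
      then show ?thesis using separated[OF st(1,3) j(1,3)] j by simp
    qed
  qed
qed

end

section \<open>Unit cells\<close>

definition floor_vec :: "real ^ 'n \<Rightarrow> real ^ 'n"
  where "floor_vec x = (\<chi> i. of_int \<lfloor>x $ i\<rfloor>)"

abbreviation int_vec :: "real ^ 'n \<Rightarrow> bool"
  where "int_vec z \<equiv> (\<forall>i. z $ i \<in> \<int>)"

lemma floor_vec_nth [simp]: "floor_vec x $ i = of_int \<lfloor>x $ i\<rfloor>"
  by (simp add: floor_vec_def)

lemma floor_vec_eq_self_iff: "floor_vec x = x \<longleftrightarrow> int_vec x"
proof -
  have "of_int \<lfloor>r\<rfloor> = r \<longleftrightarrow> r \<in> \<int>" for r :: real by (auto simp: Ints_def)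
  then show ?thesis by (simp only: vec_eq_iff floor_vec_nth)
qed

lemma floor_vec_mono: "x \<le> y \<Longrightarrow> floor_vec x \<le> floor_vec y"
  by (simp add: less_eq_vec_def floor_mono)

abbreviation cell :: "real ^ 'n \<Rightarrow> (real ^ 'n) set"
  where "cell z \<equiv> box z (z + 1)"

lemma floor_vec_cell:
  assumes "int_vec z" "x \<in> cell z"
  shows "floor_vec x = z"
proof (unfold vec_eq_iff, rule allI)
  fix i
  obtain k where k: "z $ i = of_int k" using assms(1) by (metis Ints_cases)
  have "z $ i < x $ i" "x $ i < z $ i + 1" using assms(2) by (auto simp: mem_box_cart)
  then have "\<lfloor>x $ i\<rfloor> = k" unfolding k by (intro floor_unique) auto
  then show "floor_vec x $ i = z $ i" by (simp add: k)
qed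

lemma cell_diff: "x + j \<in> cell z \<longleftrightarrow> x \<in> cell (z - j)"
  by (simp add: mem_box_cart algebra_simps)

lemma eventually_diag_in_floor_cell: "\<forall>\<^sub>F e in at_right (0::real). x + e *\<^sub>R 1 \<in> cell (floor_vec x)"
proof -
  have "\<forall>\<^sub>F e in at_right (0::real). \<forall>i\<in>UNIV. e < of_int \<lfloor>x $ i\<rfloor> + 1 - x $ i"
    by (intro eventually_ball_finite ballI order_tendstoD[of _ 0] tendsto_ident_at finite) linarith
  moreover have "\<forall>\<^sub>F r in at_right (0::real). 0 < r" by (rule eventually_at_right_less)
  ultimately show ?thesis
    by eventually_elim (auto simp: mem_box_cart less_diff_eq algebra_simps intro: le_less_trans[OF of_int_floor_le])
qed

section \<open>Tilings with unit steps on the axes\<close>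

locale unit_orthant_tile = orthant_tile T J for T J :: "(real ^ 'n) set" +
  assumes unit_J: "axis i 1 \<in> J"
    and axis_J_ge_1: "\<lbrakk>axis i s \<in> J; 0 < s\<rbrakk> \<Longrightarrow> 1 \<le> s"
begin

text \<open>Only points of \<open>J\<close> on the same axis lie below \<open>axis i s\<close>, and the first one after \<open>0\<close> is at distance
  \<open>1\<close>.\<close>

lemma corner_axis:
  assumes "0 \<le> s" "s < 1"
  shows "corner (axis i s)"
proof (rule cornerI[of _ 1])
  show "0 \<le> axis i s" using assms by (simp add: less_eq_vec_def axis_def)
  fix j t assume j: "j \<in> J" "j \<le> axis i s"
  have "j $ k = 0" if "k \<noteq> i" for k
  proof -
    have "0 \<le> j $ k" "j $ k \<le> axis i s $ k"
      using nonneg_J[OF j(1)] j(2) by (auto simp only: less_eq_vec_def zero_index)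
    then show ?thesis using that by (simp add: axis_def)
  qed
  then have eq: "j = axis i (j $ i)" by (auto simp: vec_eq_iff axis_def)
  have "j $ i \<le> s" using j(2) by (simp add: less_eq_vec_def) (metis axis_nth)
  then have "j $ i \<le> 0" using axis_J_ge_1[of i "j $ i"] eq j assms by force
  then have "j $ i = 0" using nonneg_J[OF j(1)] by (simp add: less_eq_vec_def antisym)
  then show "j = 0" using eq by simp
qed simp

lemma corner_0: "corner 0"
proof -
  have "axis undefined 0 = (0 :: real ^ 'n)" by (simp add: vec_eq_iff axis_def)
  then show ?thesis using corner_axis[of 0 undefined] by (metis order_refl zero_less_one)
qed

definition cell_fits :: "real ^ 'n \<Rightarrow> bool"
  where "cell_fits z \<longleftrightarrow> (\<forall>j\<in>J. floor_vec j = z \<longrightarrow> j = z) \<and> (cell z \<subseteq> T \<or> cell z \<inter> T = {})"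

text \<open>The two halves of \<open>cell_fits\<close> have to be proved together: that lattice translates respect cell \<open>z\<close> needs
  the second half at smaller points, and that no fractional translate enters cell \<open>z\<close> from below
  needs the first.\<close>

lemma cell_fits_step:
  assumes z: "int_vec z" "0 \<le> z"
    and IH: "\<And>w. \<lbrakk>int_vec w; 0 \<le> w; w \<le> z; w \<noteq> z\<rbrakk> \<Longrightarrow> cell_fits w"
  shows "cell_fits z"
proof -
  have floor_nonneg: "0 \<le> floor_vec j" if "j \<in> J" for j
    using nonneg_J[OF that] by (simp add: less_eq_vec_def)
  have int_floor: "int_vec (floor_vec x)" for x :: "real ^ 'n" by simp
  have int_J: "floor_vec j = z \<or> j = floor_vec j" if "j \<in> J" "floor_vec j \<le> z" for j
    using IH[OF int_floor floor_nonneg[OF that(1)] that(2)] that by (auto simp: cell_fits_def)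
  \<comment> \<open>The part of cell \<open>z\<close> in \<open>T + j\<close> is a translate of the part of cell \<open>z - j\<close> in \<open>T\<close>; outside the
    orthant that part is empty.\<close>
  have fit: "cell (z - j) \<subseteq> T \<or> cell (z - j) \<inter> T = {}"
    if j: "j \<in> J" "int_vec j" "j \<noteq> 0" for j
  proof (cases "0 \<le> z - j")
    case True
    have "z - j \<le> z" "z - j \<noteq> z" using j nonneg_J[OF j(1)] by auto
    then show ?thesis using IH[of "z - j"] True z j by (auto simp: cell_fits_def)
  next
    case False
    have "floor_vec x = z - j" if "x \<in> cell (z - j)" for x
      using floor_vec_cell[OF _ that] z j by simp
    moreover have "0 \<le> floor_vec x" if "x \<in> T" for x
      using nonneg_T[OF that] by (simp add: less_eq_vec_def)
    ultimately show ?thesis using False by fastforce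
  qed
  show ?thesis
  proof (cases "\<exists>j\<in>J. int_vec j \<and> j \<noteq> 0 \<and> cell (z - j) \<subseteq> T")
    case True
    then obtain j where j: "j \<in> J" "int_vec j" "j \<noteq> 0" "cell (z - j) \<subseteq> T" by blast
    have int: "cell (z - j) \<subseteq> interior T" using j(4) by (simp add: interior_maximal open_box)
    have only_j: "j' = j" if "t \<in> T" "j' \<in> J" "t + j' \<in> cell z" for t j'
    proof -
      have "t + j' - j \<in> cell (z - j)" using that cell_diff[of "t + j' - j" j z] by simp
      then show ?thesis using separated[of "t + j' - j" t j j'] int that j by auto
    qed
    have "j' = z" if j': "j' \<in> J" "floor_vec j' = z" for j'
    proof -
      have "\<forall>\<^sub>F e in at_right (0::real). 0 + e *\<^sub>R 1 \<in> interior T \<and> j' + e *\<^sub>R 1 \<in> cell z"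
        using corner_0 eventually_diag_in_floor_cell[of j'] j' by (simp add: corner_def eventually_conj)
      then obtain e :: real where "0 + e *\<^sub>R 1 \<in> interior T" "j' + e *\<^sub>R 1 \<in> cell z"
        using eventually_happens' trivial_limit_at_right_real by blast
      then have "j' = j" 
        using only_j[of "e *\<^sub>R 1" j'] interior_subset[of T] j' by (auto simp: add.commute)
      then show ?thesis using j j' floor_vec_eq_self_iff by metis
    qed
    moreover have "cell z \<inter> T = {}" using only_j[of _ 0] zero_J j(3) by auto
    ultimately show ?thesis by (simp add: cell_fits_def)
  next
    case False
    then have int_only: "j = 0" if "j \<in> J" "int_vec j" "t \<in> T" "t + j \<in> cell z" for j t
      using fit[of j] that cell_diff[of t j z] by blast
    have no_frac: "j = z" if jJ: "j \<in> J" "floor_vec j = z" for j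
    proof (rule ccontr)
      assume "j \<noteq> z"
      define F where "F = {j \<in> J. floor_vec j = z \<and> j \<noteq> z}"
      have "F \<subseteq> {j \<in> J. j \<le> z + 1}"
      proof
        fix x assume "x \<in> F"
        then have x: "x \<in> J" "floor_vec x = z" by (auto simp: F_def)
        have "x $ i \<le> z $ i + 1" for i
          using x(2) by (auto simp: vec_eq_iff) (metis less_imp_le floor_vec_nth real_of_int_floor_add_one_gt)
        then show "x \<in> {j \<in> J. j \<le> z + 1}" using x by (simp add: less_eq_vec_def)
      qed
      then have "finite F" using finite_J_below finite_subset by blast
      moreover have "F \<noteq> {}" using jJ \<open>j \<noteq> z\<close> by (auto simp: F_def)
      ultimately obtain m where m: "m \<in> F" "\<And>x. x \<in> F \<Longrightarrow> x \<le> m \<Longrightarrow> m = x"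
        using finite_has_minimal[of F] by blast
      then have mJ: "m \<in> J" "floor_vec m = z" "m \<noteq> z" by (auto simp: F_def)
      \<comment> \<open>Slide \<open>m\<close> back along a fractional coordinate to the facet of the cell: there no fractional
        translate reaches, by minimality of \<open>m\<close>.\<close>
      obtain i where "m $ i \<noteq> z $ i" using mJ(3) by (auto simp: vec_eq_iff)
      have zm: "z $ k \<le> m $ k" "m $ k < z $ k + 1" for k
        using mJ(2) by auto
      define f where "f = m $ i - z $ i"
      have f: "0 < f" "f < 1" using \<open>m $ i \<noteq> z $ i\<close> zm[of i] by (auto simp: f_def)
      define x where "x = m - axis i f"
      have zx: "z \<le> x" using zm by (auto simp: x_def f_def less_eq_vec_def axis_def)
      have xm: "x \<le> m" "x \<noteq> m" using f by (auto simp: x_def less_eq_vec_def axis_def vec_eq_iff)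
      have fx: "floor_vec x = z"
        using floor_vec_mono[OF zx] floor_vec_mono[OF xm(1)] mJ(2) z(1) floor_vec_eq_self_iff[of z]
        by simp
      obtain d :: real where d: "0 < d" "x + d *\<^sub>R 1 \<in> cell z"
      proof -
        have "\<forall>\<^sub>F e in at_right (0::real). 0 < e \<and> x + e *\<^sub>R 1 \<in> cell z"
          using eventually_diag_in_floor_cell[of x] fx by (simp add: eventually_conj eventually_at_right_less)
        then show thesis using that eventually_happens' trivial_limit_at_right_real by blast
      qed
      have "corner x"
      proof (rule cornerI[OF _ d(1)])
        show "0 \<le> x" using zx z by simp
        fix j t assume j: "j \<in> J" "t \<in> T" "j \<le> x" "t + j \<in> box x (x + d *\<^sub>R 1)"
        have "floor_vec j \<le> z" using floor_vec_mono[OF j(3)] fx by simp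
        then have "floor_vec j = z \<or> j = floor_vec j" using int_J j by blast
        moreover have "j \<notin> F" using m(2)[of j] j(3) xm by force
        ultimately have "int_vec j" using j(1) z by (auto simp: F_def simp flip: floor_vec_eq_self_iff)
        moreover have "t + j \<in> cell z"
          using j(4) d(2) zx unfolding mem_box_cart less_eq_vec_def
          by (meson le_less_trans less_trans)
        ultimately show "j = 0" using int_only j by blast
      qed
      \<comment> \<open>The translates of \<open>T\<close> by \<open>axis i 1\<close> and by \<open>m\<close> now collide just above the same point.\<close>
      moreover have "corner (axis i (1 - f))" using f by (intro corner_axis) auto
      moreover have "x + axis i 1 = axis i (1 - f) + m"
        by (simp add: x_def vec_eq_iff axis_def)
      ultimately have "axis i 1 = m" using corners_disjoint unit_J mJ(1) by blast
      then have "int_vec m" by (auto simp: axis_def)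
      then show False using mJ floor_vec_eq_self_iff by metis
    qed
    moreover have "cell z \<subseteq> T"
    proof
      fix y assume y: "y \<in> cell z"
      have "0 \<le> y" using box_imp_le(1)[OF y] z(2) order_trans by blast
      then obtain t j where tj: "t \<in> T" "j \<in> J" "y = t + j" using cover by blast
      have "j \<le> y" using nonneg_T[OF tj(1)] tj(3) by simp
      then have "floor_vec j \<le> z" using floor_vec_mono[of j y] floor_vec_cell[OF z(1) y] by simp
      then have "int_vec j" using int_J[OF tj(2)] no_frac[OF tj(2)] floor_vec_eq_self_iff by metis
      then show "y \<in> T" using int_only[OF tj(2) _ tj(1)] tj y by simp
    qed
    ultimately show ?thesis by (simp add: cell_fits_def)
  qed
qed

lemma cell_fits:
  assumes "int_vec z" "0 \<le> z"
  shows "cell_fits z"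
  using assms
proof (induction "nat (\<Sum>i\<in>UNIV. \<lfloor>z $ i\<rfloor>)" arbitrary: z rule: less_induct)
  case less
  show ?case
  proof (rule cell_fits_step)
    fix w assume w: "int_vec w" "0 \<le> w" "w \<le> z" "w \<noteq> z"
    have le: "\<lfloor>w $ i\<rfloor> \<le> \<lfloor>z $ i\<rfloor>" for i using w by (simp add: less_eq_vec_def floor_mono)
    have "floor_vec w \<noteq> floor_vec z" using w less.prems by (metis floor_vec_eq_self_iff)
    then obtain i where "\<lfloor>w $ i\<rfloor> \<noteq> \<lfloor>z $ i\<rfloor>" by (auto simp: vec_eq_iff)
    then have "(\<Sum>i\<in>UNIV. \<lfloor>w $ i\<rfloor>) < (\<Sum>i\<in>UNIV. \<lfloor>z $ i\<rfloor>)"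
      using le by (intro sum_strict_mono_ex1) (auto simp: less_le)
    moreover have "0 \<le> (\<Sum>i\<in>UNIV. \<lfloor>w $ i\<rfloor>)"
      using w by (intro sum_nonneg) (simp add: less_eq_vec_def)
    ultimately show "cell_fits w" using less.hyps w by simp
  qed (use less.prems in auto)
qed

lemma J_int: "j \<in> J \<Longrightarrow> int_vec j"
proof -
  assume j: "j \<in> J"
  have "cell_fits (floor_vec j)"
    using nonneg_J[OF j] by (intro cell_fits) (auto simp: less_eq_vec_def)
  then have "j = floor_vec j" using j by (auto simp: cell_fits_def)
  then show ?thesis using floor_vec_eq_self_iff by metis
qed

lemma cell_subset_T:
  assumes "x \<in> T" "x \<in> cell z" "int_vec z"
  shows "0 \<le> z" "cell z \<subseteq> T"
proof -
  have "0 \<le> floor_vec x" using nonneg_T[OF assms(1)] by (simp add: less_eq_vec_def)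
  then show "0 \<le> z" using floor_vec_cell[OF assms(3,2)] by simp
  then show "cell z \<subseteq> T" using cell_fits[OF assms(3)] assms by (auto simp: cell_fits_def)
qed

definition cells :: "(real ^ 'n) set"
  where "cells = {z \<in> nonneg_int_orthant. cell z \<subseteq> T}"

lemma cbox_subset_T: "z \<in> cells \<Longrightarrow> cbox z (z + 1) \<subseteq> T"
proof -
  assume "z \<in> cells"
  then have "closure (cell z) \<subseteq> T"
    using compact_T by (intro closure_minimal) (auto simp: cells_def compact_imp_closed)
  moreover have "z + (1/2) *\<^sub>R 1 \<in> cell z" by (simp add: mem_box_cart)
  then have "closure (cell z) = cbox z (z + 1)" by (intro closure_box) blast
  ultimately show ?thesis by simp
qed

lemma finite_cells: "finite cells"
proof -
  have "uniform_discrete cells"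
    unfolding uniform_discrete_def
  proof (intro exI[of _ 1] conjI ballI impI)
    fix x y assume xy: "x \<in> cells" "y \<in> cells" "dist x y < 1"
    show "x = y"
    proof (unfold vec_eq_iff, rule allI)
      fix i
      have "\<bar>x $ i - y $ i\<bar> < 1"
        using xy(3) component_le_norm_cart[of "x - y" i] by (simp add: dist_norm)
      moreover have "x $ i \<in> \<int>" "y $ i \<in> \<int>" using xy by (auto simp: cells_def nonneg_int_orthant_def)
      ultimately show "x $ i = y $ i" by (metis Ints_eq_abs_less1)
    qed
  qed simp
  moreover have "cells \<subseteq> T" using cbox_subset_T by (force simp: mem_box_cart)
  then have "bounded cells" using compact_T bounded_subset compact_imp_bounded by blast
  ultimately show ?thesis using uniform_discrete_finite_iff by blast
qed

text \<open>Moving diagonally from an interior point \<open>x\<close> of \<open>T\<close> enters the open cell at \<open>floor_vec x\<close>, even if \<open>x\<close>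
  lies on the grid; hence \<open>T\<close> contains that cell. The rest of \<open>T\<close> follows because a finite union of closed
  cells is closed.\<close>

lemma T_eq_cells: "T = cells + cbox 0 1"
proof
  show "cells + cbox 0 1 \<subseteq> T"
  proof
    fix x assume "x \<in> cells + cbox 0 1"
    then obtain z y where "z \<in> cells" "y \<in> cbox 0 1" "x = z + y" by (auto elim: set_plus_elim)
    then show "x \<in> T" using cbox_subset_T[of z] by (auto simp: mem_box_cart)
  qed
  have "interior T \<subseteq> cells + cbox 0 1"
  proof
    fix x assume x: "x \<in> interior T"
    have "((\<lambda>e. x + e *\<^sub>R 1) \<longlongrightarrow> x + 0 *\<^sub>R 1) (at_right (0::real))"
      by (intro tendsto_intros)
    then have "\<forall>\<^sub>F e in at_right (0::real). x + e *\<^sub>R 1 \<in> interior T"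
      using x by (intro topological_tendstoD) auto
    then have "\<forall>\<^sub>F e in at_right (0::real). x + e *\<^sub>R 1 \<in> interior T \<and> x + e *\<^sub>R 1 \<in> cell (floor_vec x)"
      using eventually_diag_in_floor_cell by (rule eventually_conj)
    then obtain e :: real where "x + e *\<^sub>R 1 \<in> interior T" "x + e *\<^sub>R 1 \<in> cell (floor_vec x)"
      using eventually_happens' trivial_limit_at_right_real by blast
    then have "0 \<le> floor_vec x" "cell (floor_vec x) \<subseteq> T"
      using cell_subset_T interior_subset[of T] by (auto simp: subset_iff)
    then have "floor_vec x \<in> cells"
      by (auto simp: cells_def nonneg_int_orthant_def less_eq_vec_def)
    moreover have "x - floor_vec x \<in> cbox 0 1"
      by (auto simp: mem_box_cart) linarith
    ultimately show "x \<in> cells + cbox 0 1" by (metis add_diff_cancel_left' diff_add_cancel add.commute set_plus_intro)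
  qed
  moreover have "closed (cells + cbox 0 1)"
    using finite_cells compact_sums'[of cells "cbox 0 1"]
    by (intro compact_imp_closed) (auto simp: finite_imp_compact set_plus_def intro: back_subst[of compact])
  ultimately show "T \<subseteq> cells + cbox 0 1"
    using regular_T closure_minimal by metis
qed

lemma J_nonneg_int: "J \<subseteq> nonneg_int_orthant"
  using J_int nonneg_J by (auto simp: nonneg_int_orthant_def less_eq_vec_def)

text \<open>The centre of the cell at \<open>x\<close> avoids the grid, so it is covered by exactly one translate, and the
  cell of \<open>T\<close> used there is the one at \<open>x - j\<close>.\<close>

lemma int_orthant_tiling_cells: "int_orthant_tiling cells J"
  unfolding int_orthant_tiling_def
proof (intro conjI ballI)
  show "cells \<subseteq> nonneg_int_orthant" by (auto simp: cells_def)
  show "J \<subseteq> nonneg_int_orthant" by (fact J_nonneg_int)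
  show "finite cells" by (fact finite_cells)
  let ?h = "(1/2) *\<^sub>R 1 :: real ^ 'n"
  have half: "z + ?h \<in> cell z" for z by (simp add: mem_box_cart)
  fix x :: "real ^ 'n" assume x: "x \<in> nonneg_int_orthant"
  show "\<exists>!(a, b). a \<in> cells \<and> b \<in> J \<and> x = a + b"
  proof (rule ex_ex1I)
    have "0 \<le> x + ?h" using x by (auto simp: less_eq_vec_def nonneg_int_orthant_def intro: add_nonneg_nonneg)
    then obtain t j where tj: "t \<in> T" "j \<in> J" "x + ?h = t + j" using cover by blast
    then have "t = x - j + ?h" by (simp add: algebra_simps)
    then have "t \<in> cell (x - j)" using half by simp
    moreover have int: "int_vec (x - j)" using x J_int[OF tj(2)] by (auto simp: nonneg_int_orthant_def)
    ultimately have "0 \<le> x - j" "cell (x - j) \<subseteq> T" using cell_subset_T tj by blast+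
    then have "x - j \<in> cells" using int by (simp add: cells_def nonneg_int_orthant_def less_eq_vec_def)
    then show "\<exists>p. case p of (a, b) \<Rightarrow> a \<in> cells \<and> b \<in> J \<and> x = a + b"
      using tj by (intro exI[of _ "(x - j, j)"]) simp
    fix p q :: "(real ^ 'n) \<times> (real ^ 'n)"
    assume p: "case p of (a, b) \<Rightarrow> a \<in> cells \<and> b \<in> J \<and> x = a + b"
      and q: "case q of (a, b) \<Rightarrow> a \<in> cells \<and> b \<in> J \<and> x = a + b"
    obtain a b where ab: "p = (a, b)" by force
    obtain a' b' where ab': "q = (a', b')" by force
    have "cell a \<subseteq> interior T" "cell a' \<subseteq> T"
      using p q ab ab' by (simp_all add: cells_def interior_maximal open_box)
    then have "a + ?h \<in> interior T" "a' + ?h \<in> T" using half by blast+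
    moreover have "a + ?h + b = a' + ?h + b'" using p q ab ab' by (simp add: algebra_simps)
    ultimately have "b = b'" using separated p q ab ab' by blast
    then show "p = q" using p q ab ab' by auto
  qed
qed

end

section \<open>Rescaling the axes\<close>

theorem corollary1p2:
  fixes T J :: "(real ^ 'n) set"
  assumes "compact T"
    and "T = closure (interior T)"
    and "discrete J"
    and "0 \<in> T" and "0 \<in> J"
    and "T \<subseteq> nonneg_orthant" and "J \<subseteq> nonneg_orthant"
    and "orthant_tiling T J"
  shows "\<exists>(E :: (real ^ 'n) set) (J' :: (real ^ 'n) set) (u :: real ^ 'n).
           E \<subseteq> nonneg_int_orthant \<and> J' \<subseteq> nonneg_int_orthant \<and>
           (\<forall>i. 0 < u $ i) \<and>
           (\<lambda>x. diag_matrix u *v x) ` T = E + {x. \<forall>i. 0 \<le> x $ i \<and> x $ i \<le> 1} \<and>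
           (\<lambda>x. diag_matrix u *v x) ` J = J' \<and>
           int_orthant_tiling E J'"
proof -
  interpret orthant_tile T J
    using assms by (intro orthant_tile_of_orthant_tiling)
  obtain a where a: "\<And>i. 0 < a i" "\<And>i. axis i (a i) \<in> J"
      and a_le: "\<And>i s. 0 < s \<Longrightarrow> axis i s \<in> J \<Longrightarrow> a i \<le> s"
    using least_on_axis by metis
  define u :: "real ^ 'n" where "u = (\<chi> i. 1 / a i)"
  let ?D = "\<lambda>x. diag_matrix u *v x"
  have u: "0 < u $ i" for i using a(1) by (simp add: u_def)
  have D_axis: "?D (axis i s) = axis i (s / a i)" for i s
    by (auto simp: vec_eq_iff diag_matrix_mult_nth axis_def u_def)
  interpret D: unit_orthant_tile "?D ` T" "?D ` J"
  proof (intro unit_orthant_tile.intro orthant_tile_diag u unit_orthant_tile_axioms.intro)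
    show "axis i 1 \<in> ?D ` J" for i
      using a[of i] D_axis[of i "a i"] by (intro image_eqI[of _ _ "axis i (a i)"]) auto
    show "1 \<le> s" if s: "axis i s \<in> ?D ` J" "0 < s" for i s
    proof -
      obtain j where j: "j \<in> J" "axis i s = ?D j" using s by auto
      have "j = axis i (s * a i)"
      proof (unfold vec_eq_iff, rule allI)
        fix k
        have "axis i s $ k = u $ k * j $ k" using j(2) by (simp add: diag_matrix_mult_nth)
        then show "j $ k = axis i (s * a i) $ k"
          using a(1)[of k] by (auto simp: axis_def u_def field_simps split: if_splits)
      qed
      then have "a i \<le> s * a i" using a_le[of "s * a i" i] j s a(1)[of i] by auto
      then show ?thesis using a(1)[of i] by simp
    qed
  qed
  have "{x :: real ^ 'n. \<forall>i. 0 \<le> x $ i \<and> x $ i \<le> 1} = cbox 0 1"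
    by (auto simp: mem_box_cart)
  then show ?thesis
    using D.T_eq_cells D.int_orthant_tiling_cells D.J_nonneg_int u
    by (intro exI[of _ D.cells] exI[of _ "?D ` J"] exI[of _ u]) (auto simp: D.cells_def)
qed

end
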